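(* Let $H$ and $G$ be separable Hilbert spaces, let $S:G\to H$ be an isomorphism, and let $F\subset G$ be a quasi-normed subspace of $G$ such that the embedding $F\hookrightarrow G$ is compact. Then for all $C\ge 1$ and all $n\in\mathbb N$, $$e^{\rm cont}_{4n+1}(S,F,H)\le 2\,C^2\,e^{\rm frame}_{n,C}(S,F,H).$$
   Context: All vector spaces are over $\mathbb R$; $\mathbb N=\{1,2,\dots\}$; $\langle\cdot,\cdot\rangle_{H\times H'}$ is the duality pairing between a Hilbert space $H$ and its dual $H'$; $I$ denotes identity (embedding) operators; an isomorphism is a bounded linear bijection with bounded inverse. A quasi-normed subspace $F$ of $G$ is a linear subspace carrying its own quasi-norm $\|\cdot\|_F$. Weights and frame pairs. A weight is a sequence $w=(w_k)_{k\in\mathbb N}$ of positive numbers, and $\ell_{2,w}$ is the space of sequences $a$ with $\|a\|_{\ell_{2,w}}=(\sum_k w_k|a_k|^2)^{1/2}<\infty$. Let $H$ be a separable Hilbert space. Two sequences $\mathcal F=\{h_k\}_{k\in\mathbb N}\subset H'$, $\mathcal G=\{g_k\}_{k\in\mathbb N}\subset H$ form a frame pair $(\mathcal F,\mathcal G)$ for $(H,w)$ if $f=\sum_{k}\langle f,h_k\rangle_{H\times H'}g_k$ for all $f\in H$, if with some constants $A,B>0$ $$A\,\|(\langle f,h_k\rangle)_k\|_{\ell_{2,w}}\le\|f\|_H\le B\,\|(\langle f,h_k\rangle)_k\|_{\ell_{2,w}}\quad\text{for all } f\in H,$$ and if there is a bounded linear operator $R:\ell_{2,w}\to H$ with $R(\delta_k)=g_k$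 for all $k$ ($\delta_k$ the canonical unit sequences) and $\|R\|\le B$. Other countable index sets are also allowed. For a subspace $K\subset H$, the pair is stable with respect to $K$ if there is $A'>0$ with $$A'\,\|(\langle f,h_k\rangle)_{k\in\Lambda}\|_{\ell_{2,w}}\le\Big\|\sum_{k\in\Lambda}\langle f,h_k\rangle g_k\Big\|_H$$ for all finite $\Lambda\subset\mathbb N$ and all $f\in K$. For $C\ge1$, $\mathcal P_C(K)$ denotes the set of all frame pairs for $(H,w)$ (for some weight $w$) that are stable with respect to $K$ and have constants satisfying $B/\min(A,A')\le C$. Manifold widths. For a quasi-normed space $F$ and a bounded linear operator $S:F\to H$, $$e_n^{\rm cont}(S,F,H)=\inf_{N_n,\varphi_n}\ \sup_{\|f\|_F\le1}\|S(f)-\varphi_n(N_n(f))\|_H,$$ the infimum over all continuous $N_n:F\to\mathbb R^n$ and $\varphi_n:\mathbb R^n\to H$. Nonlinear frame widths. Let $G,H$ be separable Hilbert spaces, $S:G\to H$ an isomorphism, $F$ a quasi-normed subspace of $G$. Equip $S(F)$ with the quasi-norm $\|S(f)\|_{S(F)}:=\|f\|_F$, and every subspace $K\subset S(F)$ with the quasi-norm of $S(F)$. For $C\ge1$ let $\mathcal K_C$ be the set of all subspaces $K\subset S(F)$ with $e_n^{\rm cont}(I,S(F),H)\le C\,e_n^{\rm cont}(I,K,H)$ for all $n\in\mathbb N$. Put $$\sigma_n(u,(\mathcal F,\mathcal G))=\inf_{|\Lambda|\le n}\Big\|u-\sum_{k\in\Lambda}\langle u,h_k\rangle_{H\times H'}g_k\Big\|_H,$$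 $$e^{\rm frame}_{n,C}(S,F,H)=\inf\Big\{\sup_{\|f\|_F\le1}\sigma_n(S(f),(\mathcal F,\mathcal G)) : (\mathcal F,\mathcal G)\in\mathcal P_C(K),\ K\in\mathcal K_C\Big\}.$$ *)

theory Defs
  imports "HOL-Analysis.Analysis"
begin

section \<open>Quasi-normed subspaces\<close>

definition quasinormed_subspace :: "'a::real_vector set \<Rightarrow> ('a \<Rightarrow> real) \<Rightarrow> bool" where
  "quasinormed_subspace F q \<longleftrightarrow>
     subspace F \<and>
     (\<forall>x\<in>F. 0 \<le> q x) \<and>
     (\<forall>x\<in>F. q x = 0 \<longleftrightarrow> x = 0) \<and>
     (\<forall>c. \<forall>x\<in>F. q (c *\<^sub>R x) = \<bar>c\<bar> * q x) \<and>
     (\<exists>M\<ge>1. \<forall>x\<in>F. \<forall>y\<in>F. q (x + y) \<le> M * (q x + q y))"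

text \<open>The topology that \<open>q\<close> induces on \<open>F\<close>. The \<open>q\<close>-balls around a point form a
  neighbourhood base there, but for a quasi-norm they need not be open themselves.\<close>

definition quasinorm_topology :: "'a::real_vector set \<Rightarrow> ('a \<Rightarrow> real) \<Rightarrow> 'a topology" where
  "quasinorm_topology F q =
     topology (\<lambda>U. U \<subseteq> F \<and> (\<forall>x\<in>U. \<exists>r>0. \<forall>y\<in>F. q (y - x) < r \<longrightarrow> y \<in> U))"

lemma openin_quasinorm_topology:
  "openin (quasinorm_topology F q) U \<longleftrightarrow>
     U \<subseteq> F \<and> (\<forall>x\<in>U. \<exists>r>0. \<forall>y\<in>F. q (y - x) < r \<longrightarrow> y \<in> U)"
proof -
  let ?P = "\<lambda>U. U \<subseteq> F \<and> (\<forall>x\<in>U. \<exists>r>0. \<forall>y\<in>F. q (y - x) < r \<longrightarrow> y \<in> U)"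
  have "istopology ?P"
    unfolding istopology_def
  proof (rule conjI; intro allI impI)
    fix U V assume U: "?P U" and V: "?P V"
    have "\<exists>r>0. \<forall>y\<in>F. q (y - x) < r \<longrightarrow> y \<in> U \<inter> V" if x: "x \<in> U \<inter> V" for x
    proof -
      from U x obtain r where r: "r > 0" "\<forall>y\<in>F. q (y - x) < r \<longrightarrow> y \<in> U" by blast
      from V x obtain s where s: "s > 0" "\<forall>y\<in>F. q (y - x) < s \<longrightarrow> y \<in> V" by blast
      show ?thesis
        by (rule exI[of _ "min r s"]) (use r s in auto)
    qed
    then show "?P (U \<inter> V)" using U by blast
  next
    fix \<K> assume K: "\<forall>U\<in>\<K>. ?P U"
    then show "?P (\<Union>\<K>)" by (meson UnionE UnionI Union_least)
  qed
  then show ?thesis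
    unfolding quasinorm_topology_def by simp
qed

lemma topspace_quasinorm_topology [simp]: "topspace (quasinorm_topology F q) = F"
proof -
  have "openin (quasinorm_topology F q) F"
    unfolding openin_quasinorm_topology by (auto intro: exI[of _ 1])
  then show ?thesis
    by (meson openin_quasinorm_topology openin_subset openin_topspace subset_antisym)
qed

definition compactly_embedded :: "'a::real_normed_vector set \<Rightarrow> ('a \<Rightarrow> real) \<Rightarrow> bool" where
  "compactly_embedded F q \<longleftrightarrow> compact (closure {f \<in> F. q f \<le> 1})"

definition isomorphism :: "('g::real_normed_vector \<Rightarrow> 'h::real_normed_vector) \<Rightarrow> bool" where
  "isomorphism S \<longleftrightarrow> bounded_linear S \<and> bij S \<and> bounded_linear (inv S)"


section \<open>Manifold widths\<close>

text \<open>All widths are extended nonnegative reals: an unbounded error has supremum \<open>\<infinity>\<close>, and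
  the infimum over an empty class is \<open>\<infinity>\<close>.\<close>

definition e_cont ::
  "nat \<Rightarrow> ('a::real_vector \<Rightarrow> 'h::real_normed_vector) \<Rightarrow> 'a set \<Rightarrow> ('a \<Rightarrow> real) \<Rightarrow> ennreal" where
  "e_cont n T F q =
     (INF (N, \<phi>) \<in> {N. continuous_map (quasinorm_topology F q) (Euclidean_space n) N} \<times>
                   {\<phi>. continuous_map (Euclidean_space n) euclidean \<phi>}.
        SUP f \<in> {f \<in> F. q f \<le> 1}. ennreal (norm (T f - \<phi> (N f))))"


section \<open>Frame pairs\<close>

text \<open>A countable index set is represented by a set \<open>I\<close> of natural numbers, and a family
  over \<open>I\<close> by a function on all of \<open>nat\<close>, of which only the values on \<open>I\<close> are used.
  Elements of the weighted sequence space over \<open>I\<close> vanish outside \<open>I\<close>.\<close>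

definition ell2w :: "nat set \<Rightarrow> (nat \<Rightarrow> real) \<Rightarrow> (nat \<Rightarrow> real) set" where
  "ell2w I w = {a. (\<forall>k. k \<notin> I \<longrightarrow> a k = 0) \<and> (\<lambda>k. w k * \<bar>a k\<bar>\<^sup>2) summable_on I}"

definition ell2w_norm :: "nat set \<Rightarrow> (nat \<Rightarrow> real) \<Rightarrow> (nat \<Rightarrow> real) \<Rightarrow> real" where
  "ell2w_norm I w a = sqrt (\<Sum>\<^sub>\<infinity>k\<in>I. w k * \<bar>a k\<bar>\<^sup>2)"

definition coeffs ::
  "nat set \<Rightarrow> (nat \<Rightarrow> 'h::real_normed_vector \<Rightarrow>\<^sub>L real) \<Rightarrow> 'h \<Rightarrow> nat \<Rightarrow> real" where
  "coeffs I h f = (\<lambda>k. if k \<in> I then blinfun_apply (h k) f else 0)"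

text \<open>\<open>R\<close> is linear on the weighted sequence space, with operator norm at most \<open>B\<close>.\<close>

definition bounded_linear_ell2w ::
  "nat set \<Rightarrow> (nat \<Rightarrow> real) \<Rightarrow> real \<Rightarrow> ((nat \<Rightarrow> real) \<Rightarrow> 'h::real_normed_vector) \<Rightarrow> bool" where
  "bounded_linear_ell2w I w B R \<longleftrightarrow>
     (\<forall>a\<in>ell2w I w. \<forall>b\<in>ell2w I w. R (\<lambda>k. a k + b k) = R a + R b) \<and>
     (\<forall>c. \<forall>a\<in>ell2w I w. R (\<lambda>k. c * a k) = c *\<^sub>R R a) \<and>
     (\<forall>a\<in>ell2w I w. norm (R a) \<le> B * ell2w_norm I w a)"

definition frame_pair ::
  "nat set \<Rightarrow> (nat \<Rightarrow> real) \<Rightarrow> real \<Rightarrow> real \<Rightarrow>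
   (nat \<Rightarrow> 'h::real_normed_vector \<Rightarrow>\<^sub>L real) \<Rightarrow> (nat \<Rightarrow> 'h) \<Rightarrow> bool" where
  "frame_pair I w A B h g \<longleftrightarrow>
     (\<forall>k\<in>I. 0 < w k) \<and> 0 < A \<and> 0 < B \<and>
     (\<forall>f. ((\<lambda>k. blinfun_apply (h k) f *\<^sub>R g k) has_sum f) I) \<and>
     (\<forall>f. coeffs I h f \<in> ell2w I w \<and>
          A * ell2w_norm I w (coeffs I h f) \<le> norm f \<and>
          norm f \<le> B * ell2w_norm I w (coeffs I h f)) \<and>
     (\<exists>R. bounded_linear_ell2w I w B R \<and>
          (\<forall>k\<in>I. R (\<lambda>j. if j = k then 1 else 0) = g k))"

definition stable_wrt ::
  "nat set \<Rightarrow> (nat \<Rightarrow> real) \<Rightarrow> real \<Rightarrow>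
   (nat \<Rightarrow> 'h::real_normed_vector \<Rightarrow>\<^sub>L real) \<Rightarrow> (nat \<Rightarrow> 'h) \<Rightarrow> 'h set \<Rightarrow> bool" where
  "stable_wrt I w A' h g K \<longleftrightarrow>
     0 < A' \<and>
     (\<forall>\<Lambda> f. finite \<Lambda> \<and> \<Lambda> \<subseteq> I \<and> f \<in> K \<longrightarrow>
        A' * ell2w_norm I w (coeffs \<Lambda> h f) \<le> norm (\<Sum>k\<in>\<Lambda>. blinfun_apply (h k) f *\<^sub>R g k))"

definition stable_frame_pairs ::
  "real \<Rightarrow> 'h::real_normed_vector set \<Rightarrow> (nat set \<times> (nat \<Rightarrow> 'h \<Rightarrow>\<^sub>L real) \<times> (nat \<Rightarrow> 'h)) set" where
  "stable_frame_pairs C K =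
     {(I, h, g). \<exists>w A B A'. frame_pair I w A B h g \<and> stable_wrt I w A' h g K \<and> B / min A A' \<le> C}"


section \<open>Nonlinear frame widths\<close>

definition image_quasinorm :: "('g \<Rightarrow> 'h) \<Rightarrow> ('g \<Rightarrow> real) \<Rightarrow> 'h \<Rightarrow> real" where
  "image_quasinorm S q = (\<lambda>u. q (inv S u))"

definition width_subspaces ::
  "real \<Rightarrow> ('g \<Rightarrow> 'h::real_normed_vector) \<Rightarrow> 'g set \<Rightarrow> ('g \<Rightarrow> real) \<Rightarrow> 'h set set" where
  "width_subspaces C S F q =
     {K. subspace K \<and> K \<subseteq> S ` F \<and>
         (\<forall>n\<ge>1. e_cont n id (S ` F) (image_quasinorm S q)
                  \<le> ennreal C * e_cont n id K (image_quasinorm S q))}"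

definition sigma_n ::
  "nat \<Rightarrow> 'h::real_normed_vector \<Rightarrow> nat set \<times> (nat \<Rightarrow> 'h \<Rightarrow>\<^sub>L real) \<times> (nat \<Rightarrow> 'h) \<Rightarrow> ennreal" where
  "sigma_n n u = (\<lambda>(I, h, g).
     INF \<Lambda> \<in> {\<Lambda>. \<Lambda> \<subseteq> I \<and> finite \<Lambda> \<and> card \<Lambda> \<le> n}.
       ennreal (norm (u - (\<Sum>k\<in>\<Lambda>. blinfun_apply (h k) u *\<^sub>R g k))))"

definition e_frame ::
  "nat \<Rightarrow> real \<Rightarrow> ('g \<Rightarrow> 'h::real_normed_vector) \<Rightarrow> 'g set \<Rightarrow> ('g \<Rightarrow> real) \<Rightarrow> ennreal" where
  "e_frame n C S F q =
     (INF P \<in> (\<Union>K \<in> width_subspaces C S F q. stable_frame_pairs C K).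
        SUP f \<in> {f \<in> F. q f \<le> 1}. sigma_n n (S f) P)"

end

theory Submission
  imports Defs
begin

text \<open>
  Fix a subspace \<open>K\<close> and a frame pair that is stable on it. A best \<open>n\<close>-term expansion is a
  discontinuous function of \<open>u\<close>, since the chosen index set jumps. Soft thresholding of the
  coefficients is continuous and costs only a constant factor, and what it produces is sparse enough
  to be transmitted continuously through finitely many real numbers.
  
  If \<open>u \<in> K\<close> is approximated up to \<open>s\<close> by the frame terms with indices in \<open>\<Lambda>\<close>, \<open>card \<Lambda> \<le> n\<close>, then
  stability bounds the weighted \<open>l\<^sub>2\<close> norm of the coefficients outside \<open>\<Lambda>\<close> by \<open>\<eta> = s / A'\<close>
  (\<open>stable_tail_bound\<close>). Soft thresholding of the weighted coefficients at the fixed level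
  \<open>\<eta> / sqrt n\<close> therefore leaves at most \<open>2 n\<close> nonzero entries: those in \<open>\<Lambda>\<close>, and at most \<open>n\<close> others,
  because each of these carries at least \<open>\<eta>\<^sup>2 / n\<close> of a tail of total mass \<open>\<eta>\<^sup>2\<close>. It changes the coefficients
  by at most \<open>2 \<eta>\<close> (\<open>soft_threshold_sparse\<close>). As the level does not depend on \<open>u\<close>, this is a continuous
  operation, and the synthesis operator turns the error into at most \<open>2 (B / A') s \<le> 2 C s\<close>.
  
  Compactness of the unit ball allows all of this to take place in one finite index set \<open>J\<close>, up to an
  arbitrarily small error (\<open>frame_sum_uniform_on_compact\<close>). Two \<open>2 n\<close>-sparse vectors differ in at most
  \<open>4 n\<close> entries, so by a Vandermonde argument they are told apart by their first \<open>4 n + 1\<close> moments,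
  with a Lipschitz inverse (\<open>sparse_bounded_by_moments\<close>); a Lipschitz extension of this inverse is the
  decoder (\<open>sparse_continuous_decoding\<close>). The resulting bound on the manifold width of \<open>K\<close> is
  \<open>frame_expansion_width_bound\<close>.
  
  Passing from \<open>K\<close> to the whole image \<open>S ` F\<close> costs the second factor \<open>C\<close>, by the definition of
  \<open>width_subspaces\<close>, and the width of the inclusion of \<open>S ` F\<close> dominates that of \<open>S\<close> on \<open>F\<close>
  because \<open>S\<close> is an isometry between the two quasi-norms (\<open>e_cont_image_le\<close>).
\<close>

section \<open>Encoding sparse vectors by moments\<close>

definition moments :: "nat \<Rightarrow> nat set \<Rightarrow> (nat \<Rightarrow> real) \<Rightarrow> nat \<Rightarrow> real" where
  "moments m J y = (\<lambda>i. if i < m then \<Sum>j\<in>J. y j * real j ^ i else 0)"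

lemma moments_diff: "moments m J (\<lambda>k. x k - y k) i = moments m J x i - moments m J y i"
  by (simp add: moments_def left_diff_distrib sum_subtractf)

text \<open>
  Lagrange interpolation: for the support \<open>T\<close> of \<open>y\<close> and \<open>k \<in> T\<close>, the polynomial that vanishes at
  the nodes in \<open>T - {k}\<close> has degree below \<open>card T \<le> m\<close>, so pairing it with \<open>y\<close> isolates
  \<open>y k\<close> as a combination of the first \<open>m\<close> moments. There are only finitely many supports inside \<open>J\<close>,
  which makes the constant uniform.
\<close>

lemma sparse_bounded_by_moments:
  assumes J: "finite J"
  shows "\<exists>L\<ge>0. \<forall>y. card {j \<in> J. y j \<noteq> 0} \<le> m \<longrightarrow>
           (\<forall>k\<in>J. \<bar>y k\<bar> \<le> L * (\<Sum>i<m. \<bar>moments m J y i\<bar>))"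
proof -
  define p :: "nat set \<Rightarrow> nat \<Rightarrow> real poly" where
    "p T k = (\<Prod>j\<in>T - {k}. [:- real j, 1:])" for T k
  define c where "c T k = (\<Sum>i<m. \<bar>coeff (p T k) i\<bar>) / \<bar>poly (p T k) (real k)\<bar>" for T k
  have c0: "c T k \<ge> 0" for T k
    by (simp add: c_def sum_nonneg)
  define L where "L = (\<Sum>T\<in>Pow J. \<Sum>k\<in>J. c T k)"
  have L0: "L \<ge> 0"
    unfolding L_def by (intro sum_nonneg c0)
  have "\<bar>y k\<bar> \<le> L * (\<Sum>i<m. \<bar>moments m J y i\<bar>)"
    if card: "card {j \<in> J. y j \<noteq> 0} \<le> m" and k: "k \<in> J" for y k
  proof (cases "y k = 0")
    case True
    then show ?thesis using L0 by (simp add: sum_nonneg)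
  next
    case False
    define T where "T = {j \<in> J. y j \<noteq> 0}"
    have T: "finite T" "T \<subseteq> J" "k \<in> T" "card T \<le> m"
      using J k False card by (auto simp: T_def)
    let ?p = "p T k"
    have pk: "poly ?p (real k) \<noteq> 0"
      using T by (auto simp: p_def poly_prod)
    have pj: "poly ?p (real j) = 0" if "j \<in> T" "j \<noteq> k" for j
      using T that by (auto simp: p_def poly_prod)
    have "degree ?p \<le> (\<Sum>j\<in>T - {k}. 1)"
      unfolding p_def using degree_prod_sum_le[of "T - {k}" "\<lambda>j. [:- real j, 1:]"] T(1)
      by (simp add: comp_def)
    also have "\<dots> < m"
      using T by (metis One_nat_def card_Diff1_less card_eq_sum order_less_le_trans)
    finally have deg: "degree ?p < m" .
    have poly: "poly ?p x = (\<Sum>i<m. coeff ?p i * x ^ i)" for x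
      unfolding poly_altdef using deg
      by (intro sum.mono_neutral_left) (auto simp: coeff_eq_0)
    have "(\<Sum>j\<in>J. y j * poly ?p (real j)) = (\<Sum>j\<in>{k}. y j * poly ?p (real j))"
      using J k pj by (intro sum.mono_neutral_right) (auto simp: T_def)
    then have "y k * poly ?p (real k) = (\<Sum>j\<in>J. \<Sum>i<m. coeff ?p i * (y j * real j ^ i))"
      by (simp add: poly sum_distrib_left mult_ac)
    also have "\<dots> = (\<Sum>i<m. coeff ?p i * moments m J y i)"
      by (subst sum.swap) (simp add: moments_def sum_distrib_left)
    finally have "\<bar>y k\<bar> * \<bar>poly ?p (real k)\<bar> = \<bar>\<Sum>i<m. coeff ?p i * moments m J y i\<bar>"
      by (simp flip: abs_mult)
    also have "\<dots> \<le> (\<Sum>i<m. \<bar>coeff ?p i\<bar> * \<bar>moments m J y i\<bar>)"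
      by (metis (no_types, lifting) abs_mult sum.cong sum_abs)
    also have "\<dots> \<le> (\<Sum>i<m. \<bar>coeff ?p i\<bar> * (\<Sum>i<m. \<bar>moments m J y i\<bar>))"
      by (intro sum_mono mult_left_mono member_le_sum) auto
    also have "\<dots> = (\<Sum>i<m. \<bar>coeff ?p i\<bar>) * (\<Sum>i<m. \<bar>moments m J y i\<bar>)"
      by (simp add: sum_distrib_right)
    finally have "\<bar>y k\<bar> \<le> c T k * (\<Sum>i<m. \<bar>moments m J y i\<bar>)"
      using pk by (simp add: c_def field_simps)
    also have "c T k \<le> (\<Sum>k\<in>J. c T k)"
      using J k c0 by (intro member_le_sum) auto
    also have "\<dots> \<le> L"
      unfolding L_def using J T c0
      by (intro member_le_sum[where f = "\<lambda>T. \<Sum>k\<in>J. c T k"] sum_nonneg) auto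
    finally show ?thesis
      by (simp add: mult_right_mono sum_nonneg)
  qed
  then show ?thesis using L0 by blast
qed

text \<open>
  McShane's construction: the lower envelope of the cones with slope \<open>L\<close> placed over the points
  \<open>E x\<close> at heights \<open>f x\<close>. The set \<open>D\<close> only parametrises these points, so \<open>E\<close> may be an encoding.
\<close>

lemma lipschitz_extension:
  fixes E :: "'a \<Rightarrow> nat \<Rightarrow> real" and f :: "'a \<Rightarrow> real"
  assumes L: "0 \<le> L"
    and lip: "\<And>x y. x \<in> D \<Longrightarrow> y \<in> D \<Longrightarrow> \<bar>f x - f y\<bar> \<le> L * (\<Sum>i<m. \<bar>E x i - E y i\<bar>)"
  shows "\<exists>g. continuous_on UNIV g \<and> (\<forall>x\<in>D. g (E x) = f x)"
proof (cases "D = {}")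
  case True
  then show ?thesis by (intro exI[of _ "\<lambda>_. 0"]) auto
next
  case False
  define d where "d y z = (\<Sum>i<m. \<bar>y i - z i\<bar>)" for y z :: "nat \<Rightarrow> real"
  have tri: "d x z \<le> d x y + d y z" for x y z
    unfolding d_def sum.distrib[symmetric] by (intro sum_mono) auto
  have sym: "d x y = d y x" for x y
    unfolding d_def by (intro sum.cong) auto
  have lip': "f x - f y \<le> L * d (E x) (E y)" if "x \<in> D" "y \<in> D" for x y
    using lip[OF that] by (simp add: d_def)
  define g where "g z = (INF x\<in>D. f x + L * d z (E x))" for z
  have bdd: "bdd_below ((\<lambda>x. f x + L * d z (E x)) ` D)" for z
  proof -
    obtain a where a: "a \<in> D" using False by blast
    have "f a - L * d z (E a) \<le> f x + L * d z (E x)" if "x \<in> D" for x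
    proof -
      have "L * d (E a) (E x) \<le> L * (d z (E a) + d z (E x))"
        using tri[of "E a" "E x" z] sym L by (intro mult_left_mono) auto
      then show ?thesis using lip'[OF a that] by (simp add: algebra_simps)
    qed
    then show ?thesis by (auto intro!: bdd_belowI)
  qed
  have le: "g z \<le> g z' + L * d z z'" for z z'
  proof -
    have "g z - L * d z z' \<le> f x + L * d z' (E x)" if x: "x \<in> D" for x
    proof -
      have "g z \<le> f x + L * d z (E x)"
        unfolding g_def by (rule cINF_lower[OF bdd x])
      moreover have "L * d z (E x) \<le> L * (d z z' + d z' (E x))"
        using tri L by (intro mult_left_mono)
      ultimately show ?thesis by (simp add: algebra_simps)
    qed
    then have "g z - L * d z z' \<le> g z'"
      unfolding g_def[of z'] using False by (intro cINF_greatest)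
    then show ?thesis by simp
  qed
  have abs: "\<bar>g z' - g z\<bar> \<le> L * d z' z" for z z'
    using le[of z z'] le[of z' z] sym[of z z'] by (simp add: abs_le_iff)
  have "continuous_on UNIV g"
    unfolding continuous_on_def
  proof
    fix z :: "nat \<Rightarrow> real"
    have coord: "((\<lambda>x. x i) \<longlongrightarrow> z i) (at z)" for i
      using continuous_on_product_coordinates[of i] unfolding continuous_on_def by auto
    have "((\<lambda>z'. L * d z' z) \<longlongrightarrow> L * (\<Sum>i<m. \<bar>z i - z i\<bar>)) (at z)"
      unfolding d_def by (intro tendsto_intros coord)
    then have "((\<lambda>z'. L * d z' z) \<longlongrightarrow> 0) (at z)"
      by simp
    then have "((\<lambda>z'. g z' - g z) \<longlongrightarrow> 0) (at z)"
      by (rule Lim_null_comparison[rotated]) (simp add: abs)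
    then show "(g \<longlongrightarrow> g z) (at z within UNIV)"
      using LIM_zero_cancel by blast
  qed
  moreover have "g (E x) = f x" if x: "x \<in> D" for x
  proof (rule antisym)
    show "g (E x) \<le> f x"
      using cINF_lower[OF bdd x, of "E x"] by (simp add: g_def d_def)
    show "f x \<le> g (E x)"
      unfolding g_def using False lip'[OF x] by (intro cINF_greatest) (auto simp: algebra_simps)
  qed
  ultimately show ?thesis by blast
qed

text \<open>
  The difference of two \<open>s\<close>-sparse vectors is \<open>2 s\<close>-sparse, so the lower bound on moments makes
  each entry a Lipschitz function of the moments; it is then extended to all moment vectors.
\<close>

lemma sparse_continuous_decoding:
  assumes J: "finite J" and m: "2 * s \<le> m"
  shows "\<exists>D. (\<forall>k. continuous_on UNIV (D k)) \<and>
           (\<forall>x. card {j \<in> J. x j \<noteq> 0} \<le> s \<longrightarrow> (\<forall>k\<in>J. D k (moments m J x) = x k))"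
proof -
  let ?X = "{x :: nat \<Rightarrow> real. card {j \<in> J. x j \<noteq> 0} \<le> s}"
  obtain L where L: "L \<ge> 0" and bound: "\<And>y k. card {j \<in> J. y j \<noteq> 0} \<le> m \<Longrightarrow> k \<in> J \<Longrightarrow>
      \<bar>y k\<bar> \<le> L * (\<Sum>i<m. \<bar>moments m J y i\<bar>)"
    using sparse_bounded_by_moments[OF J, of m] by blast
  have lip: "\<bar>x k - y k\<bar> \<le> L * (\<Sum>i<m. \<bar>moments m J x i - moments m J y i\<bar>)"
    if x: "x \<in> ?X" and y: "y \<in> ?X" and k: "k \<in> J" for x y k
  proof -
    have "card {j \<in> J. x j - y j \<noteq> 0} \<le> card ({j \<in> J. x j \<noteq> 0} \<union> {j \<in> J. y j \<noteq> 0})"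
      using J by (intro card_mono) auto
    also have "\<dots> \<le> s + s"
      using x y by (intro order_trans[OF card_Un_le] add_mono) auto
    finally have "card {j \<in> J. x j - y j \<noteq> 0} \<le> m"
      using m by simp
    from bound[OF this k] show ?thesis
      by (simp add: moments_diff)
  qed
  have ex: "\<exists>g. continuous_on UNIV g \<and> (\<forall>x\<in>?X. k \<in> J \<longrightarrow> g (moments m J x) = x k)" for k
  proof (cases "k \<in> J")
    case True
    then show ?thesis
      using lipschitz_extension[OF L, where D = ?X and E = "moments m J" and f = "\<lambda>x. x k"] lip
      by blast
  next
    case False
    then show ?thesis by (intro exI[of _ "\<lambda>_. 0"]) auto
  qed
  have "\<exists>D. \<forall>k. continuous_on UNIV (D k) \<and> (\<forall>x\<in>?X. k \<in> J \<longrightarrow> D k (moments m J x) = x k)"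
    by (intro choice allI ex)
  then show ?thesis by auto
qed

section \<open>Soft thresholding\<close>

definition soft_threshold :: "real \<Rightarrow> real \<Rightarrow> real" where
  "soft_threshold t x = x - max (- t) (min t x)"

lemma soft_threshold_eq_0_iff: "0 \<le> t \<Longrightarrow> soft_threshold t x = 0 \<longleftrightarrow> \<bar>x\<bar> \<le> t"
  by (auto simp: soft_threshold_def max_def min_def)

lemma soft_threshold_error:
  assumes "0 \<le> t"
  shows "(x - soft_threshold t x)\<^sup>2 \<le> t\<^sup>2" and "(x - soft_threshold t x)\<^sup>2 \<le> x\<^sup>2"
  using assms by (auto simp: soft_threshold_def max_def min_def abs_le_square_iff[symmetric])

text \<open>
  The level \<open>\<eta> / sqrt n\<close> balances two demands. It is high enough that few entries off \<open>\<Lambda>\<close> survive,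
  as each survivor has square at least \<open>\<eta>\<^sup>2 / n\<close>; and it is low enough that the entries in \<open>\<Lambda>\<close> are
  disturbed by at most \<open>n \<cdot> \<eta>\<^sup>2 / n\<close> in total.
\<close>

lemma soft_threshold_sparse:
  fixes x :: "nat \<Rightarrow> real"
  assumes J: "finite J" and \<Lambda>: "finite \<Lambda>" "card \<Lambda> \<le> n" and n: "1 \<le> n" and \<eta>: "0 < \<eta>"
    and tail: "(\<Sum>k\<in>J - \<Lambda>. (x k)\<^sup>2) \<le> \<eta>\<^sup>2"
  defines "t \<equiv> \<eta> / sqrt n"
  shows "card {k \<in> J. soft_threshold t (x k) \<noteq> 0} \<le> 2 * n"
    and "(\<Sum>k\<in>J. (x k - soft_threshold t (x k))\<^sup>2) \<le> 2 * \<eta>\<^sup>2"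
proof -
  have t: "0 < t" and nt: "real n * t\<^sup>2 = \<eta>\<^sup>2"
    using n \<eta> by (auto simp: t_def power_divide)
  let ?T = "{k \<in> J - \<Lambda>. t < \<bar>x k\<bar>}"
  have "real (card ?T) * t\<^sup>2 \<le> (\<Sum>k\<in>?T. (x k)\<^sup>2)"
    using t by (intro sum_bounded_below[where K = "t\<^sup>2", simplified])
      (auto simp: abs_le_square_iff[symmetric])
  also have "\<dots> \<le> (\<Sum>k\<in>J - \<Lambda>. (x k)\<^sup>2)"
    using J by (intro sum_mono2) auto
  also have "\<dots> \<le> real n * t\<^sup>2"
    using tail nt by simp
  finally have T: "card ?T \<le> n"
    using t by simp
  have "card {k \<in> J. soft_threshold t (x k) \<noteq> 0} \<le> card (?T \<union> \<Lambda>)"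
    using J \<Lambda> t by (intro card_mono) (auto simp: soft_threshold_eq_0_iff)
  also have "\<dots> \<le> n + n"
    using T \<Lambda> by (intro order_trans[OF card_Un_le] add_mono)
  finally show "card {k \<in> J. soft_threshold t (x k) \<noteq> 0} \<le> 2 * n"
    by simp
  let ?e = "\<lambda>k. (x k - soft_threshold t (x k))\<^sup>2"
  have "(\<Sum>k\<in>J. ?e k) = (\<Sum>k\<in>J - \<Lambda>. ?e k) + (\<Sum>k\<in>J \<inter> \<Lambda>. ?e k)"
    using sum.Int_Diff[OF J, of ?e \<Lambda>] by (simp add: add.commute)
  also have "\<dots> \<le> (\<Sum>k\<in>J - \<Lambda>. (x k)\<^sup>2) + (\<Sum>k\<in>J \<inter> \<Lambda>. t\<^sup>2)"
    using t by (intro add_mono sum_mono soft_threshold_error) auto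
  also have "(\<Sum>k\<in>J \<inter> \<Lambda>. t\<^sup>2) \<le> real n * t\<^sup>2"
    using \<Lambda> card_mono[of \<Lambda> "J \<inter> \<Lambda>"] by (simp add: mult_right_mono)
  finally show "(\<Sum>k\<in>J. ?e k) \<le> 2 * \<eta>\<^sup>2"
    using tail nt by simp
qed

section \<open>Finite frame sums\<close>

lemma ell2w_finite_support:
  assumes J: "finite J" "J \<subseteq> I" and a: "\<And>k. k \<notin> J \<Longrightarrow> a k = 0"
  shows "a \<in> ell2w I w" and "ell2w_norm I w a = sqrt (\<Sum>k\<in>J. w k * (a k)\<^sup>2)"
proof -
  have "(\<lambda>k. w k * \<bar>a k\<bar>\<^sup>2) summable_on I \<longleftrightarrow> (\<lambda>k. w k * \<bar>a k\<bar>\<^sup>2) summable_on J"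
    using J a by (intro summable_on_cong_neutral) auto
  then show "a \<in> ell2w I w"
    using J a by (auto simp: ell2w_def)
  have "(\<Sum>\<^sub>\<infinity>k\<in>I. w k * \<bar>a k\<bar>\<^sup>2) = (\<Sum>\<^sub>\<infinity>k\<in>J. w k * \<bar>a k\<bar>\<^sup>2)"
    using J a by (intro infsum_cong_neutral) auto
  then show "ell2w_norm I w a = sqrt (\<Sum>k\<in>J. w k * (a k)\<^sup>2)"
    using J by (simp add: ell2w_norm_def)
qed

lemma ell2w_norm_coeffs_finite:
  assumes "finite J" "J \<subseteq> I"
  shows "ell2w_norm I w (coeffs J h f) = sqrt (\<Sum>k\<in>J. w k * (h k f)\<^sup>2)"
proof -
  have "(\<Sum>k\<in>J. w k * (coeffs J h f k)\<^sup>2) = (\<Sum>k\<in>J. w k * (h k f)\<^sup>2)"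
    by (intro sum.cong) (auto simp: coeffs_def)
  then show ?thesis
    using assms by (subst ell2w_finite_support(2)[of J]) (auto simp: coeffs_def)
qed

text \<open>
  On finitely supported sequences the bounded operator \<open>R\<close> of a frame pair is, by linearity, the
  synthesis map given by \<open>g\<close>.
\<close>

lemma finite_synthesis_bound:
  assumes fp: "frame_pair I w A B h g" and J: "finite J" "J \<subseteq> I"
  shows "norm (\<Sum>k\<in>J. x k *\<^sub>R g k) \<le> B * sqrt (\<Sum>k\<in>J. w k * (x k)\<^sup>2)"
proof -
  obtain R where R: "bounded_linear_ell2w I w B R" and
    R_unit: "\<And>k. k \<in> I \<Longrightarrow> R (\<lambda>j. if j = k then 1 else 0) = g k"
    using fp unfolding frame_pair_def by blast
  have add: "R (\<lambda>k. a k + b k) = R a + R b" if "a \<in> ell2w I w" "b \<in> ell2w I w" for a b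
    using R that unfolding bounded_linear_ell2w_def by blast
  have scale: "R (\<lambda>k. c * a k) = c *\<^sub>R R a" if "a \<in> ell2w I w" for a c
    using R that unfolding bounded_linear_ell2w_def by blast
  have R_sum: "R (\<lambda>k. if k \<in> J then x k else 0) = (\<Sum>k\<in>J. x k *\<^sub>R g k)"
    using J
  proof (induction J rule: finite_induct)
    case empty
    have "(\<lambda>_. 0) \<in> ell2w I w" by (simp add: ell2w_def)
    from scale[OF this, of 0] show ?case by simp
  next
    case (insert i J)
    let ?\<delta> = "\<lambda>j. if j = i then 1 else 0 :: real" and ?a = "\<lambda>k. if k \<in> J then x k else 0"
    have \<delta>: "?\<delta> \<in> ell2w I w" and x\<delta>: "(\<lambda>j. x i * ?\<delta> j) \<in> ell2w I w"
      using insert.prems by (auto intro!: ell2w_finite_support(1)[of "{i}"] split: if_splits)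
    have a: "?a \<in> ell2w I w"
      using insert by (intro ell2w_finite_support(1)[of J]) auto
    have "(\<lambda>k. if k \<in> insert i J then x k else 0) = (\<lambda>k. x i * ?\<delta> k + ?a k)"
      using insert.hyps by auto
    then have "R (\<lambda>k. if k \<in> insert i J then x k else 0) = x i *\<^sub>R g i + R ?a"
      using add[OF x\<delta> a] scale[OF \<delta>, of "x i"] R_unit[of i] insert.prems by simp
    then show ?case using insert by simp
  qed
  let ?b = "\<lambda>k. if k \<in> J then x k else 0"
  have "?b \<in> ell2w I w" "ell2w_norm I w ?b = sqrt (\<Sum>k\<in>J. w k * (?b k)\<^sup>2)"
    using J by (intro ell2w_finite_support; auto)+
  moreover have "(\<Sum>k\<in>J. w k * (?b k)\<^sup>2) = (\<Sum>k\<in>J. w k * (x k)\<^sup>2)"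
    by (intro sum.cong) auto
  ultimately show ?thesis
    using R R_sum unfolding bounded_linear_ell2w_def by metis
qed

definition frame_sum :: "(nat \<Rightarrow> 'h::real_normed_vector \<Rightarrow>\<^sub>L real) \<Rightarrow> (nat \<Rightarrow> 'h) \<Rightarrow> nat set \<Rightarrow> 'h \<Rightarrow> 'h"
  where "frame_sum h g J u = (\<Sum>k\<in>J. h k u *\<^sub>R g k)"

lemma frame_sum_diff: "frame_sum h g J (u - v) = frame_sum h g J u - frame_sum h g J v"
  by (simp add: frame_sum_def blinfun.diff_right scaleR_diff_left sum_subtractf)

lemma frame_sum_tendsto:
  assumes "frame_pair I w A B h g"
  shows "((\<lambda>J. frame_sum h g J u) \<longlongrightarrow> u) (finite_subsets_at_top I)"
  using assms unfolding frame_pair_def has_sum_def frame_sum_def by blast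

lemma norm_frame_sum_le:
  assumes fp: "frame_pair I w A B h g" and J: "finite J" "J \<subseteq> I"
  shows "norm (frame_sum h g J u) \<le> B / A * norm u"
proof -
  have w: "\<And>k. k \<in> I \<Longrightarrow> 0 < w k" and A: "0 < A" and B: "0 < B"
    and coeffs: "coeffs I h u \<in> ell2w I w" "A * ell2w_norm I w (coeffs I h u) \<le> norm u"
    using fp unfolding frame_pair_def by blast+
  have "(\<Sum>k\<in>J. w k * (h k u)\<^sup>2) = (\<Sum>k\<in>J. w k * \<bar>coeffs I h u k\<bar>\<^sup>2)"
    using J by (intro sum.cong) (auto simp: coeffs_def)
  also have "\<dots> \<le> (\<Sum>\<^sub>\<infinity>k\<in>I. w k * \<bar>coeffs I h u k\<bar>\<^sup>2)"
    using coeffs(1) J w by (intro finite_sum_le_infsum) (auto simp: ell2w_def less_imp_le)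
  finally have "sqrt (\<Sum>k\<in>J. w k * (h k u)\<^sup>2) \<le> ell2w_norm I w (coeffs I h u)"
    by (simp add: ell2w_norm_def)
  also have "\<dots> \<le> norm u / A"
    using coeffs(2) A by (simp add: field_simps)
  finally have "B * sqrt (\<Sum>k\<in>J. w k * (h k u)\<^sup>2) \<le> B * (norm u / A)"
    using B by (intro mult_left_mono) auto
  then show ?thesis
    using finite_synthesis_bound[OF fp J, of "\<lambda>k. h k u"] by (simp add: frame_sum_def)
qed

text \<open>
  Frame expansions converge pointwise and the partial sums are equibounded by \<open>B / A\<close>; on a compact
  set, pointwise convergence on a finite net then gives uniform convergence.
\<close>

lemma frame_sum_uniform_on_compact:
  assumes fp: "frame_pair I w A B h g" and Q: "compact Q" and \<delta>: "0 < \<delta>"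
  obtains J where "finite J" "J \<subseteq> I" "\<And>u. u \<in> Q \<Longrightarrow> norm (u - frame_sum h g J u) \<le> \<delta>"
proof -
  have AB: "0 < A" "0 < B" using fp unfolding frame_pair_def by blast+
  \<comment> \<open>The error splits into twice the net radius and a partial sum, amplified by \<open>B / A\<close>.\<close>
  define r where "r = \<delta> / (2 + B / A)"
  have pos: "0 < 2 + B / A" using AB by (simp add: add_pos_pos)
  then have r: "0 < r" and "r * (2 + B / A) = \<delta>"
    using \<delta> by (auto simp: r_def)
  then have r_sum: "r + r + B / A * r = \<delta>"
    by (simp add: algebra_simps)
  obtain N where N: "finite N" "Q \<subseteq> (\<Union>v\<in>N. ball v r)"
    using Q r unfolding compact_eq_totally_bounded by blast
  have "\<forall>\<^sub>F J in finite_subsets_at_top I. \<forall>v\<in>N. dist (frame_sum h g J v) v < r"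
    using N(1) tendstoD[OF frame_sum_tendsto[OF fp] r] by (simp add: eventually_ball_finite)
  then have "\<forall>\<^sub>F J in finite_subsets_at_top I.
      (\<forall>v\<in>N. dist (frame_sum h g J v) v < r) \<and> finite J \<and> J \<subseteq> I"
    by (rule eventually_conj) (intro eventually_finite_subsets_at_top_weakI; simp)
  then have "\<exists>J. (\<forall>v\<in>N. dist (frame_sum h g J v) v < r) \<and> finite J \<and> J \<subseteq> I"
    by (rule eventually_happens'[OF finite_subsets_at_top_neq_bot])
  then obtain J where J: "finite J" "J \<subseteq> I" and
    net: "\<And>v. v \<in> N \<Longrightarrow> dist (frame_sum h g J v) v < r"
    by blast
  have "norm (u - frame_sum h g J u) \<le> \<delta>" if u: "u \<in> Q" for u
  proof -
    obtain v where v: "v \<in> N" "dist v u < r" using N u by auto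
    have "u - frame_sum h g J u = (u - v) + (v - frame_sum h g J v) + frame_sum h g J (v - u)"
      by (simp add: frame_sum_diff)
    then have "norm (u - frame_sum h g J u)
        \<le> norm (u - v) + norm (v - frame_sum h g J v) + norm (frame_sum h g J (v - u))"
      by (metis add_right_mono norm_triangle_ineq order_trans)
    also have "\<dots> \<le> r + r + B / A * r"
    proof (intro add_mono)
      show "norm (u - v) \<le> r" using v by (simp add: dist_norm norm_minus_commute)
      show "norm (v - frame_sum h g J v) \<le> r"
        using net[OF v(1)] by (simp add: dist_norm norm_minus_commute)
      have "B / A * norm (v - u) \<le> B / A * r"
        using AB v by (intro mult_left_mono) (auto simp: dist_norm)
      then show "norm (frame_sum h g J (v - u)) \<le> B / A * r"
        using norm_frame_sum_le[OF fp J, of "v - u"] by linarith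
    qed
    finally show ?thesis using r_sum by simp
  qed
  with J show thesis by (rule that)
qed

text \<open>
  The remainder \<open>u - frame_sum h g \<Lambda> u\<close> is the limit of the sums over \<open>X - \<Lambda>\<close> for growing finite \<open>X\<close>, so
  the stability inequality for these finite sets passes to the cofinite complement of \<open>\<Lambda>\<close>.
\<close>

lemma stable_tail_bound:
  assumes fp: "frame_pair I w A B h g" and st: "stable_wrt I w A' h g K" and u: "u \<in> K"
    and \<Lambda>: "finite \<Lambda>" "\<Lambda> \<subseteq> I" and J: "finite J" "J \<subseteq> I"
  shows "A' * sqrt (\<Sum>k\<in>J - \<Lambda>. w k * (h k u)\<^sup>2) \<le> norm (u - frame_sum h g \<Lambda> u)"
proof (rule tendsto_lowerbound)
  show "((\<lambda>X. norm (frame_sum h g X u - frame_sum h g \<Lambda> u)) \<longlongrightarrow> norm (u - frame_sum h g \<Lambda> u))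
      (finite_subsets_at_top I)"
    by (intro tendsto_intros frame_sum_tendsto[OF fp])
  show "\<forall>\<^sub>F X in finite_subsets_at_top I.
      A' * sqrt (\<Sum>k\<in>J - \<Lambda>. w k * (h k u)\<^sup>2) \<le> norm (frame_sum h g X u - frame_sum h g \<Lambda> u)"
    unfolding eventually_finite_subsets_at_top
  proof (intro exI[of _ "J \<union> \<Lambda>"] conjI allI impI)
    fix X assume X: "finite X \<and> J \<union> \<Lambda> \<subseteq> X \<and> X \<subseteq> I"
    have w: "\<And>k. k \<in> I \<Longrightarrow> 0 < w k" using fp unfolding frame_pair_def by blast
    have A': "0 < A'" using st unfolding stable_wrt_def by blast
    have "(\<Sum>k\<in>J - \<Lambda>. w k * (h k u)\<^sup>2) \<le> (\<Sum>k\<in>X - \<Lambda>. w k * (h k u)\<^sup>2)"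
      using X w by (intro sum_mono2) (auto simp: less_imp_le subset_iff)
    then have "A' * sqrt (\<Sum>k\<in>J - \<Lambda>. w k * (h k u)\<^sup>2)
        \<le> A' * ell2w_norm I w (coeffs (X - \<Lambda>) h u)"
      using X A' by (subst ell2w_norm_coeffs_finite) auto
    also have "\<dots> \<le> norm (frame_sum h g (X - \<Lambda>) u)"
      using st X u unfolding stable_wrt_def frame_sum_def by (meson Diff_subset finite_Diff order_trans)
    also have "frame_sum h g (X - \<Lambda>) u = frame_sum h g X u - frame_sum h g \<Lambda> u"
      using X \<Lambda> unfolding frame_sum_def by (intro sum_diff) auto
    finally show "A' * sqrt (\<Sum>k\<in>J - \<Lambda>. w k * (h k u)\<^sup>2)
        \<le> norm (frame_sum h g X u - frame_sum h g \<Lambda> u)" .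
  qed (use J \<Lambda> in auto)
qed simp

section \<open>Manifold widths\<close>

text \<open>
  The assumed bound of the norm by the quasi-norm says that the quasi-norm topology is finer than the
  norm topology of \<open>K\<close>; hence norm-continuous encoders are admissible in the manifold width.
\<close>

lemma continuous_map_quasinorm_topology:
  fixes N :: "'h::real_normed_vector \<Rightarrow> nat \<Rightarrow> real"
  assumes bound: "\<And>u. u \<in> K \<Longrightarrow> norm u \<le> M * p u" and M: "0 < M" and K: "subspace K"
    and N: "continuous_on UNIV N" and supp: "\<And>u i. m \<le> i \<Longrightarrow> N u i = 0"
  shows "continuous_map (quasinorm_topology K p) (Euclidean_space m) N"
proof -
  have "continuous_map (quasinorm_topology K p) euclidean (\<lambda>u. u)"
    unfolding continuous_map_def
  proof (intro conjI allI impI)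
    fix U :: "'h set" assume "openin euclidean U"
    then have U: "open U" by simp
    show "openin (quasinorm_topology K p) {x \<in> topspace (quasinorm_topology K p). x \<in> U}"
      unfolding openin_quasinorm_topology
    proof (intro conjI ballI)
      fix x assume "x \<in> {x \<in> topspace (quasinorm_topology K p). x \<in> U}"
      then have x: "x \<in> K" "x \<in> U" by auto
      obtain e where e: "0 < e" "\<And>y. dist y x < e \<Longrightarrow> y \<in> U"
        using U x unfolding open_dist by blast
      have "y \<in> U" if y: "y \<in> K" "p (y - x) < e / M" for y
      proof -
        have "norm (y - x) \<le> M * p (y - x)"
          using bound K x y by (simp add: subspace_diff)
        also have "\<dots> < e"
          using y M by (simp add: field_simps)
        finally show ?thesis using e by (simp add: dist_norm)
      qed
      then show "\<exists>r>0. \<forall>y\<in>K. p (y - x) < r \<longrightarrow> y \<in> {x \<in> topspace (quasinorm_topology K p). x \<in> U}"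
        using e(1) M by (intro exI[of _ "e / M"]) auto
    qed auto
  qed auto
  moreover have "continuous_map euclidean (Euclidean_space m) N"
    using N supp unfolding Euclidean_space_def euclidean_product_topology
    by (auto simp: continuous_map_in_subtopology)
  ultimately show ?thesis
    using continuous_map_compose[of _ euclidean "\<lambda>u. u" _ N] by (simp add: comp_def)
qed

lemma e_cont_le:
  assumes "continuous_map (quasinorm_topology K p) (Euclidean_space m) N"
    and "continuous_map (Euclidean_space m) euclidean \<phi>"
    and "\<And>u. u \<in> K \<Longrightarrow> p u \<le> 1 \<Longrightarrow> norm (T u - \<phi> (N u)) \<le> e"
  shows "e_cont m T K p \<le> ennreal e"
  unfolding e_cont_def
  by (rule INF_lower2[of "(N, \<phi>)"]) (use assms in \<open>auto intro!: SUP_least ennreal_leI\<close>)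

text \<open>
  The encoder takes the moments of the soft-thresholded, weighted coefficients in a finite index set
  \<open>J\<close>; the decoder recovers these coefficients, removes the weights and synthesises. The summand
  \<open>\<delta>\<close> pays for the truncation to \<open>J\<close>.
\<close>

lemma frame_expansion_width_bound:
  fixes K :: "'h::real_normed_vector set"
  assumes fp: "frame_pair I w A B h g" and st: "stable_wrt I w A' h g K"
    and K: "subspace K" and M: "0 < M" "\<And>u. u \<in> K \<Longrightarrow> norm u \<le> M * p u"
    and Q: "compact Q" "{u \<in> K. p u \<le> 1} \<subseteq> Q"
    and n: "1 \<le> n" and s: "0 < s" and \<delta>: "0 < \<delta>"
    and sigma: "\<And>u. u \<in> K \<Longrightarrow> p u \<le> 1 \<Longrightarrow> sigma_n n u (I, h, g) < ennreal s"
  shows "e_cont (4 * n + 1) id K p \<le> ennreal (\<delta> + 2 * (B / A') * s)"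
proof -
  have w: "\<And>k. k \<in> I \<Longrightarrow> 0 < w k" and B: "0 < B"
    using fp unfolding frame_pair_def by blast+
  have A': "0 < A'" using st unfolding stable_wrt_def by blast
  define m where "m = 4 * n + 1"
  obtain J where J: "finite J" "J \<subseteq> I" and
    J_approx: "\<And>u. u \<in> Q \<Longrightarrow> norm (u - frame_sum h g J u) \<le> \<delta>"
    using frame_sum_uniform_on_compact[OF fp Q(1) \<delta>] by blast
  define \<eta> where "\<eta> = s / A'"
  have \<eta>: "0 < \<eta>" using s A' by (simp add: \<eta>_def)
  define t where "t = \<eta> / sqrt n"
  \<comment> \<open>Including the root of the weight turns the weighted \<open>l\<^sub>2\<close> norm into the plain one.\<close>
  define x where "x u k = sqrt (w k) * h k u" for u k
  define b where "b u k = soft_threshold t (x u k)" for u k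
  obtain D where D: "\<And>k. continuous_on UNIV (D k)" and
    decode: "\<And>y k. card {j \<in> J. y j \<noteq> 0} \<le> 2 * n \<Longrightarrow> k \<in> J \<Longrightarrow> D k (moments m J y) = y k"
    using sparse_continuous_decoding[OF J(1), of "2 * n" m] unfolding m_def by auto
  define N where "N u = moments m J (b u)" for u
  define \<phi> where "\<phi> z = (\<Sum>k\<in>J. (D k z / sqrt (w k)) *\<^sub>R g k)" for z
  have "continuous_on UNIV (\<lambda>u. b u k)" for k
    unfolding b_def x_def soft_threshold_def by (intro continuous_intros)
  then have "continuous_on UNIV (\<lambda>u. N u i)" for i
    unfolding N_def moments_def by (cases "i < m") (auto intro!: continuous_intros)
  then have "continuous_on UNIV N"
    by (rule continuous_on_coordinatewise_then_product)
  then have N: "continuous_map (quasinorm_topology K p) (Euclidean_space m) N"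
    by (intro continuous_map_quasinorm_topology[OF M(2) M(1) K]) (auto simp: N_def moments_def)
  have "continuous_on UNIV \<phi>"
    unfolding \<phi>_def divide_inverse by (intro continuous_intros D)
  then have \<phi>: "continuous_map (Euclidean_space m) euclidean \<phi>"
    unfolding Euclidean_space_def euclidean_product_topology
    by (intro continuous_map_from_subtopology) simp
  have "norm (id u - \<phi> (N u)) \<le> \<delta> + 2 * (B / A') * s" if u: "u \<in> K" "p u \<le> 1" for u
  proof -
    obtain \<Lambda> where \<Lambda>: "\<Lambda> \<subseteq> I" "finite \<Lambda>" "card \<Lambda> \<le> n" and
      "norm (u - frame_sum h g \<Lambda> u) < s"
      using sigma[OF u] s unfolding sigma_n_def frame_sum_def
      by (auto simp: INF_less_iff ennreal_less_iff)
    then have "A' * sqrt (\<Sum>k\<in>J - \<Lambda>. w k * (h k u)\<^sup>2) \<le> s"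
      using stable_tail_bound[OF fp st u(1) \<Lambda>(2,1) J] by linarith
    moreover have "(\<Sum>k\<in>J - \<Lambda>. (x u k)\<^sup>2) = (\<Sum>k\<in>J - \<Lambda>. w k * (h k u)\<^sup>2)"
      using w J by (intro sum.cong) (auto simp: x_def power_mult_distrib less_imp_le subset_iff)
    ultimately have "sqrt (\<Sum>k\<in>J - \<Lambda>. (x u k)\<^sup>2) \<le> \<eta>"
      using A' by (simp add: \<eta>_def field_simps)
    then have tail: "(\<Sum>k\<in>J - \<Lambda>. (x u k)\<^sup>2) \<le> \<eta>\<^sup>2"
      by (rule sqrt_le_D)
    note sparse = soft_threshold_sparse[OF J(1) \<Lambda>(2,3) n \<eta> tail, folded t_def]
    have decoded: "D k (N u) = b u k" if "k \<in> J" for k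
      unfolding N_def using sparse(1) that by (intro decode) (auto simp: b_def)
    have "frame_sum h g J u - \<phi> (N u) = (\<Sum>k\<in>J. (h k u - b u k / sqrt (w k)) *\<^sub>R g k)"
      by (simp add: frame_sum_def \<phi>_def decoded sum_subtractf scaleR_diff_left)
    then have "norm (frame_sum h g J u - \<phi> (N u))
        \<le> B * sqrt (\<Sum>k\<in>J. w k * (h k u - b u k / sqrt (w k))\<^sup>2)"
      using finite_synthesis_bound[OF fp J] by simp
    also have "(\<Sum>k\<in>J. w k * (h k u - b u k / sqrt (w k))\<^sup>2) = (\<Sum>k\<in>J. (x u k - b u k)\<^sup>2)"
    proof (intro sum.cong refl)
      fix k assume "k \<in> J"
      then have "0 < w k" using w J by blast
      then have "x u k - b u k = sqrt (w k) * (h k u - b u k / sqrt (w k))"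
        by (simp add: x_def right_diff_distrib)
      then show "w k * (h k u - b u k / sqrt (w k))\<^sup>2 = (x u k - b u k)\<^sup>2"
        using \<open>0 < w k\<close> by (simp add: power_mult_distrib)
    qed
    also have "sqrt \<dots> \<le> 2 * \<eta>"
    proof (rule real_le_lsqrt)
      show "(\<Sum>k\<in>J. (x u k - b u k)\<^sup>2) \<le> (2 * \<eta>)\<^sup>2"
        using sparse(2) zero_le_power2[of \<eta>] unfolding b_def power_mult_distrib power2_eq_square[of 2] by linarith
    qed (use \<eta> in auto)
    finally have "norm (frame_sum h g J u - \<phi> (N u)) \<le> 2 * (B / A') * s"
      using B by (simp add: \<eta>_def mult_ac)
    moreover have "norm (u - frame_sum h g J u) \<le> \<delta>"
      using J_approx Q(2) u by blast
    ultimately show ?thesis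
      using norm_triangle_ineq[of "u - frame_sum h g J u" "frame_sum h g J u - \<phi> (N u)"] by simp
  qed
  then have "e_cont m id K p \<le> ennreal (\<delta> + 2 * (B / A') * s)"
    by (rule e_cont_le[OF N \<phi>])
  then show ?thesis by (simp only: m_def)
qed

text \<open>
  A compact set is bounded, so the quasi-norm unit ball is norm-bounded, and homogeneity does the rest.
\<close>

lemma compactly_embedded_norm_bound:
  assumes F: "quasinormed_subspace F q" and cpt: "compactly_embedded F q"
  obtains M where "0 < M" "\<And>x. x \<in> F \<Longrightarrow> norm x \<le> M * q x"
proof -
  have "bounded {f \<in> F. q f \<le> 1}"
    using cpt unfolding compactly_embedded_def
    by (rule bounded_subset[OF compact_imp_bounded closure_subset])
  then obtain M where M: "0 < M" "\<And>f. f \<in> F \<Longrightarrow> q f \<le> 1 \<Longrightarrow> norm f \<le> M"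
    unfolding bounded_pos by blast
  have "norm x \<le> M * q x" if x: "x \<in> F" for x
  proof (cases "x = 0")
    case True
    then show ?thesis using F x M unfolding quasinormed_subspace_def by auto
  next
    case False
    then have q: "0 < q x"
      using F x unfolding quasinormed_subspace_def by (metis less_eq_real_def)
    have "(1 / q x) *\<^sub>R x \<in> F" and "q ((1 / q x) *\<^sub>R x) = 1"
      using F x q unfolding quasinormed_subspace_def by (auto simp: subspace_scale)
    then have "norm ((1 / q x) *\<^sub>R x) \<le> M" by (intro M(2)) simp_all
    then show ?thesis using q by (simp add: field_simps)
  qed
  with M(1) show thesis by (rule that)
qed

text \<open>
  By definition of \<open>image_quasinorm\<close>, \<open>S\<close> carries \<open>q\<close> to the quasi-norm of \<open>S ` F\<close>, so composing an
  encoder on \<open>S ` F\<close> with \<open>S\<close> gives an encoder on \<open>F\<close> with the same error.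
\<close>

lemma e_cont_image_le:
  fixes S :: "'a::real_vector \<Rightarrow> 'b::real_normed_vector"
  assumes inj: "inj S" and lin: "linear S"
  shows "e_cont m S F q \<le> e_cont m id (S ` F) (image_quasinorm S q)"
  unfolding e_cont_def
proof (rule INF_mono)
  fix P assume P: "P \<in> {N. continuous_map (quasinorm_topology (S ` F) (image_quasinorm S q)) (Euclidean_space m) N} \<times>
                   {\<phi>. continuous_map (Euclidean_space m) (euclidean :: 'b topology) \<phi>}"
  obtain N \<phi> where P_eq: "P = (N, \<phi>)" by (cases P)
  have "continuous_map (quasinorm_topology F q) (quasinorm_topology (S ` F) (image_quasinorm S q)) S"
    unfolding continuous_map_def
  proof (intro conjI allI impI)
    fix U assume "openin (quasinorm_topology (S ` F) (image_quasinorm S q)) U"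
    then have U: "\<And>x. x \<in> U \<Longrightarrow> \<exists>r>0. \<forall>y\<in>S ` F. q (inv S (y - x)) < r \<longrightarrow> y \<in> U"
      unfolding openin_quasinorm_topology image_quasinorm_def by blast
    have inv: "inv S (S y - S x) = y - x" for x y
      using inj lin by (metis inv_f_f linear_diff)
    show "openin (quasinorm_topology F q) {x \<in> topspace (quasinorm_topology F q). S x \<in> U}"
      unfolding openin_quasinorm_topology
    proof (intro conjI ballI)
      fix x assume x: "x \<in> {x \<in> topspace (quasinorm_topology F q). S x \<in> U}"
      then obtain r where r: "0 < r" "\<And>y. y \<in> S ` F \<Longrightarrow> q (inv S (y - S x)) < r \<Longrightarrow> y \<in> U"
        using U[of "S x"] by auto
      then have "\<forall>y\<in>F. q (y - x) < r \<longrightarrow> y \<in> {x \<in> topspace (quasinorm_topology F q). S x \<in> U}"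
        using inv by simp
      with r(1) show "\<exists>r>0. \<forall>y\<in>F. q (y - x) < r \<longrightarrow> y \<in> {x \<in> topspace (quasinorm_topology F q). S x \<in> U}"
        by blast
    qed auto
  qed auto
  then have "continuous_map (quasinorm_topology F q) (Euclidean_space m) (N \<circ> S)"
    using P P_eq continuous_map_compose by blast
  moreover have "(SUP f \<in> {f \<in> F. q f \<le> 1}. ennreal (norm (S f - \<phi> ((N \<circ> S) f))))
      \<le> (SUP u \<in> {u \<in> S ` F. image_quasinorm S q u \<le> 1}. ennreal (norm (id u - \<phi> (N u))))"
  proof (rule SUP_mono)
    fix f assume "f \<in> {f \<in> F. q f \<le> 1}"
    then have "S f \<in> {u \<in> S ` F. image_quasinorm S q u \<le> 1}"
      using inj by (simp add: image_quasinorm_def)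
    then show "\<exists>u\<in>{u \<in> S ` F. image_quasinorm S q u \<le> 1}.
        ennreal (norm (S f - \<phi> ((N \<circ> S) f))) \<le> ennreal (norm (id u - \<phi> (N u)))"
      by (intro bexI[of _ "S f"]) auto
  qed
  ultimately show "\<exists>P'\<in>{N. continuous_map (quasinorm_topology F q) (Euclidean_space m) N} \<times>
        {\<phi>. continuous_map (Euclidean_space m) (euclidean :: 'b topology) \<phi>}.
      (case P' of (N, \<phi>) \<Rightarrow> SUP f \<in> {f \<in> F. q f \<le> 1}. ennreal (norm (S f - \<phi> (N f))))
      \<le> (case P of (N, \<phi>) \<Rightarrow> SUP u \<in> {u \<in> S ` F. image_quasinorm S q u \<le> 1}. ennreal (norm (id u - \<phi> (N u))))"
    using P P_eq by (intro bexI[of _ "(N \<circ> S, \<phi>)"]) auto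
qed

section \<open>Comparison with nonlinear frame widths\<close>

theorem theorem1:
  fixes S :: "'g::{real_inner,complete_space} \<Rightarrow> 'h::{real_inner,complete_space}"
    and F :: "'g set" and q :: "'g \<Rightarrow> real" and C :: real and n :: nat
  assumes "separable_space (euclidean :: 'g topology)"
    and "separable_space (euclidean :: 'h topology)"
    and "isomorphism S"
    and "quasinormed_subspace F q"
    and "compactly_embedded F q"
    and "1 \<le> C" and "1 \<le> n"
  shows "e_cont (4 * n + 1) S F q \<le> ennreal (2 * C\<^sup>2) * e_frame n C S F q"
proof -
  note C = \<open>1 \<le> C\<close>
  let ?p = "image_quasinorm S q" and ?e = "e_cont (4 * n + 1) S F q"
  have S: "bounded_linear S" "bij S"
    using assms(3) unfolding isomorphism_def by auto
  have inv_S: "inv S (S f) = f" for f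
    using S(2) by (simp add: bij_is_inj)
  define Q where "Q = S ` closure {f \<in> F. q f \<le> 1}"
  have Q: "compact Q"
    unfolding Q_def using assms(5) S(1)
    by (intro compact_continuous_image linear_continuous_on) (auto simp: compactly_embedded_def)
  have ball: "{u \<in> S ` F. ?p u \<le> 1} \<subseteq> Q"
    using closure_subset unfolding Q_def by (fastforce simp: image_quasinorm_def inv_S)
  obtain M where M: "0 < M" "\<And>x. x \<in> F \<Longrightarrow> norm x \<le> M * q x"
    using compactly_embedded_norm_bound[OF assms(4,5)] by blast
  obtain L where L: "0 < L" "\<And>x. norm (S x) \<le> norm x * L"
    using bounded_linear.pos_bounded[OF S(1)] by blast
  have norm_le: "norm u \<le> M * L * ?p u" if u: "u \<in> S ` F" for u
  proof -
    obtain f where f: "f \<in> F" "u = S f" using u by blast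
    have "norm f * L \<le> M * q f * L" using M(2)[OF f(1)] L(1) by (intro mult_right_mono) auto
    then show ?thesis using L(2)[of f] f by (simp add: image_quasinorm_def inv_S mult_ac)
  qed
  have pair_bound: "?e \<le> ennreal (2 * C\<^sup>2) * (SUP f \<in> {f \<in> F. q f \<le> 1}. sigma_n n (S f) P)"
    if K: "K \<in> width_subspaces C S F q" and P: "P \<in> stable_frame_pairs C K" for K P
  proof (cases "SUP f \<in> {f \<in> F. q f \<le> 1}. sigma_n n (S f) P" rule: ennreal_cases)
    case top
    show ?thesis unfolding top using C by (simp add: ennreal_mult_top)
  next
    case (real \<epsilon>)
    obtain I h g w A B A' where P_eq: "P = (I, h, g)" and fp: "frame_pair I w A B h g"
      and st: "stable_wrt I w A' h g K" and ratio: "B / min A A' \<le> C"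
      using P unfolding stable_frame_pairs_def by blast
    have pos: "0 < A" "0 < B" "0 < A'"
      using fp st unfolding frame_pair_def stable_wrt_def by blast+
    have "B / A' \<le> B / min A A'" using pos by (intro divide_left_mono) auto
    then have BA: "B / A' \<le> C" using ratio by linarith
    have K_sub: "subspace K" "K \<subseteq> S ` F" and
      K_width: "e_cont (4 * n + 1) id (S ` F) ?p \<le> ennreal C * e_cont (4 * n + 1) id K ?p"
      using K unfolding width_subspaces_def by auto
    have sigma_le: "sigma_n n u (I, h, g) \<le> ennreal \<epsilon>" if u: "u \<in> K" "?p u \<le> 1" for u
    proof -
      obtain f where f: "f \<in> F" "u = S f" using u K_sub by blast
      then have "q f \<le> 1" using u by (simp add: image_quasinorm_def inv_S)
      then have "sigma_n n (S f) P \<le> (SUP f \<in> {f \<in> F. q f \<le> 1}. sigma_n n (S f) P)"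
        using f by (intro SUP_upper) auto
      then show ?thesis using real f P_eq by simp
    qed
    have "?e \<le> ennreal (2 * C\<^sup>2 * \<epsilon>)"
    proof (rule ennreal_le_epsilon)
      fix r :: real assume r: "0 < r"
      \<comment> \<open>One \<open>\<delta>\<close> serves both as truncation error and as the excess of a near-optimal
        \<open>n\<close>-term error over \<open>\<epsilon>\<close>; the latter keeps the threshold positive when \<open>\<epsilon> = 0\<close>.\<close>
      define \<delta> where "\<delta> = r / (C + 2 * C\<^sup>2)"
      have C2: "0 < C + 2 * C\<^sup>2" using C by (simp add: add_pos_nonneg)
      have \<delta>: "0 < \<delta>" "\<delta> * (C + 2 * C\<^sup>2) = r" using r C2 by (auto simp: \<delta>_def)
      have "sigma_n n u (I, h, g) < ennreal (\<epsilon> + \<delta>)" if "u \<in> K" "?p u \<le> 1" for u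
        using sigma_le[OF that] real \<delta> by (auto intro: le_less_trans simp: ennreal_less_iff)
      then have "e_cont (4 * n + 1) id K ?p \<le> ennreal (\<delta> + 2 * (B / A') * (\<epsilon> + \<delta>))"
        using K_sub ball norm_le M(1) L(1) real \<delta>
        by (intro frame_expansion_width_bound[OF fp st K_sub(1) _ _ Q _ \<open>1 \<le> n\<close>, of "M * L"]) auto
      also have "\<dots> \<le> ennreal (\<delta> + 2 * C * (\<epsilon> + \<delta>))"
        using BA real \<delta> by (intro ennreal_leI add_left_mono mult_right_mono) auto
      finally have K_bound: "e_cont (4 * n + 1) id K ?p \<le> ennreal (\<delta> + 2 * C * (\<epsilon> + \<delta>))" .
      have "?e \<le> e_cont (4 * n + 1) id (S ` F) ?p"
        using S by (intro e_cont_image_le bounded_linear.linear bij_is_inj)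
      also have "\<dots> \<le> ennreal C * ennreal (\<delta> + 2 * C * (\<epsilon> + \<delta>))"
        using K_width K_bound by (meson mult_left_mono order_trans zero_le)
      also have "\<dots> = ennreal (C * (\<delta> + 2 * C * (\<epsilon> + \<delta>)))"
        using C real \<delta> by (intro ennreal_mult[symmetric]) auto
      also have "C * (\<delta> + 2 * C * (\<epsilon> + \<delta>)) = 2 * C\<^sup>2 * \<epsilon> + \<delta> * (C + 2 * C\<^sup>2)"
        by (simp add: algebra_simps power2_eq_square)
      also have "ennreal \<dots> = ennreal (2 * C\<^sup>2 * \<epsilon>) + ennreal r"
        using real r \<delta> by (simp add: ennreal_plus)
      finally show "?e \<le> ennreal (2 * C\<^sup>2 * \<epsilon>) + ennreal r" .
    qed
    then show ?thesis using real by (simp add: ennreal_mult)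
  qed
  have c: "0 < ennreal (2 * C\<^sup>2)" using C by simp
  have "?e / ennreal (2 * C\<^sup>2) \<le> e_frame n C S F q"
    unfolding e_frame_def using pair_bound c
    by (intro INF_greatest divide_le_posI_ennreal) (auto simp: mult.commute)
  then have "?e / ennreal (2 * C\<^sup>2) * ennreal (2 * C\<^sup>2) \<le> e_frame n C S F q * ennreal (2 * C\<^sup>2)"
    by (intro mult_right_mono) auto
  moreover have "?e / ennreal (2 * C\<^sup>2) * ennreal (2 * C\<^sup>2) = ?e"
    using c by (simp add: ennreal_divide_times mult_divide_eq_ennreal)
  ultimately show ?thesis
    by (simp only: mult.commute)
qed

end
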